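(* Let $A,B,C$ be integers with $ABC\neq 0$ and let $f(X)=AX+B+\frac{C}{X}$. Then the equation $f(x)f(y)=f(z)^2$ has infinitely many nontrivial rational solutions $(x,y,z)$.
   Context: A solution $(x,y,z)$ (with $x,y,z$ nonzero rationals, so that $f$ is defined) of $f(x)f(y)=f(z)^2$ is called nontrivial if $f(x)\neq f(y)$ and $f(z)\neq 0$. *)

theory Defs
  imports Complex_Main
begin

definition fABC :: "int \<Rightarrow> int \<Rightarrow> int \<Rightarrow> rat \<Rightarrow> rat" where
  "fABC A B C X = of_int A * X + of_int B + of_int C / X"

definition nontrivial_solutions :: "int \<Rightarrow> int \<Rightarrow> int \<Rightarrow> (rat \<times> rat \<times> rat) set" where
  "nontrivial_solutions A B C =
     {(x, y, z). x \<noteq> 0 \<and> y \<noteq> 0 \<and> z \<noteq> 0 \<and>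
        fABC A B C x * fABC A B C y = (fABC A B C z)^2 \<and>
        fABC A B C x \<noteq> fABC A B C y \<and> fABC A B C z \<noteq> 0}"

end

theory Submission
  imports Defs "HOL-Computational_Algebra.Polynomial"
begin

text \<open>After scaling, \<open>f = B (X + 1 + e / X)\<close> with \<open>e = 1 / c\<close>, \<open>c = B\<^sup>2 / (A C)\<close>. Solutions of the shape
  \<open>(x, k\<^sup>2 x, k x)\<close> form the curve \<open>c k\<^sup>2 x\<^sup>2 + (k + 1)\<^sup>2 x + 1 = 0\<close>, which is birational to
  \<open>Y\<^sup>2 = X\<^sup>3 - c X\<^sup>2 + c X\<close> via \<open>x = - 1 / X\<close>, \<open>k = (X + Y) / (c - X)\<close> and carries the point
  \<open>P = (1, 1)\<close>. Once \<open>X\<close> has a sufficiently negative 2-adic valuation, doubling lowers it further,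
  so the doubles are pairwise distinct; one of \<open>2 P\<close>, \<open>3 P\<close>, \<open>4 P\<close> is such a starting point
  unless \<open>P\<close> is torsion, which happens for \<open>c \<in> {1, 3, - 1}\<close>. In these three cases the
  genus one curve \<open>f(x) f(y) = f(z)\<^sup>2\<close> for a suitable fixed \<open>z\<close> has a point of infinite order
  by the same 2-adic argument.\<close>

section \<open>The 2-adic valuation on the rationals\<close>

text \<open>A relation rather than a function: 0 then has no valuation, while
  \<open>val2_ge 0 k\<close> holds for every \<open>k\<close>, matching valuation infinity.\<close>

definition val2 :: "rat \<Rightarrow> int \<Rightarrow> bool" where
  "val2 q k \<longleftrightarrow> (\<exists>a b. odd a \<and> odd b \<and> q = 2 powi k * of_int a / of_int b)"

definition val2_ge :: "rat \<Rightarrow> int \<Rightarrow> bool" where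
  "val2_ge q k \<longleftrightarrow> (\<exists>a b. odd b \<and> q = 2 powi k * of_int a / of_int b)"

lemma val2_imp_ge: "val2 q k \<Longrightarrow> val2_ge q k"
  unfolding val2_def val2_ge_def by blast

lemma val2_nonzero: "val2 q k \<Longrightarrow> q \<noteq> 0"
  unfolding val2_def by auto

lemma val2_exists:
  assumes "q \<noteq> 0"
  obtains k where "val2 q k"
proof -
  have nat2: "\<exists>k b. odd b \<and> a = 2 ^ k * b" if "a \<noteq> 0" for a :: int
    using that
  proof (induction "nat \<bar>a\<bar>" arbitrary: a rule: less_induct)
    case less
    show ?case
    proof (cases "odd a")
      case True
      then show ?thesis by (intro exI[of _ 0] exI[of _ a]) auto
    next
      case False
      then obtain b where b: "a = 2 * b" by auto
      with less.prems have "nat \<bar>b\<bar> < nat \<bar>a\<bar>" "b \<noteq> 0" by auto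
      from less.hyps[OF this] obtain k d where "odd d" "b = 2 ^ k * d" by blast
      then show ?thesis using b by (intro exI[of _ "Suc k"] exI[of _ d]) auto
    qed
  qed
  obtain a b where ab: "q = of_int a / of_int b" "b \<noteq> 0"
    by (metis Fract_of_int_quotient quotient_of_div quotient_of_denom_pos' less_irrefl prod.collapse)
  with assms have "a \<noteq> 0" by auto
  then obtain k a' l b' where "odd a'" "odd b'" "a = 2 ^ k * a'" "b = 2 ^ l * b'"
    using nat2 ab(2) by metis
  then have "val2 q (int k - int l)"
    unfolding val2_def ab(1)
    by (intro exI[of _ a'] exI[of _ b']) (simp add: power_int_diff)
  then show ?thesis by (rule that)
qed

lemma val2_mult:
  assumes "val2 q k" "val2 r l"
  shows "val2 (q * r) (k + l)"
proof -
  obtain a b a' b' where "odd a" "odd b" "q = 2 powi k * of_int a / of_int b"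
    "odd a'" "odd b'" "r = 2 powi l * of_int a' / of_int b'"
    using assms unfolding val2_def by blast
  then show ?thesis unfolding val2_def
    by (intro exI[of _ "a * a'"] exI[of _ "b * b'"]) (simp add: power_int_add)
qed

lemma val2_inverse:
  assumes "val2 q k"
  shows "val2 (inverse q) (- k)"
proof -
  obtain a b where "odd a" "odd b" "q = 2 powi k * of_int a / of_int b"
    using assms unfolding val2_def by blast
  then show ?thesis unfolding val2_def
    by (intro exI[of _ b] exI[of _ a]) (simp add: power_int_minus field_simps)
qed

lemma val2_divide: "val2 q k \<Longrightarrow> val2 r l \<Longrightarrow> val2 (q / r) (k - l)"
  using val2_mult[of q k "inverse r" "- l"] val2_inverse[of r l] by (simp add: divide_inverse)

lemma val2_minus:
  assumes "val2 q k"
  shows "val2 (- q) k"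
proof -
  have "val2 (- 1) 0"
    unfolding val2_def by (intro exI[of _ "- 1"] exI[of _ 1]) simp
  from val2_mult[OF this assms] show ?thesis by simp
qed

lemma val2_one: "val2 1 0"
  unfolding val2_def by (intro exI[of _ 1]) simp

lemma val2_power: "val2 q k \<Longrightarrow> val2 (q ^ n) (int n * k)"
  by (induction n) (auto simp: val2_one algebra_simps dest: val2_mult)

lemma val2_two: "val2 2 1"
  unfolding val2_def by (intro exI[of _ 1]) simp

lemma val2_ge_mult:
  assumes "val2_ge q k" "val2_ge r l"
  shows "val2_ge (q * r) (k + l)"
proof -
  obtain a b a' b' where "odd b" "q = 2 powi k * of_int a / of_int b"
    "odd b'" "r = 2 powi l * of_int a' / of_int b'"
    using assms unfolding val2_ge_def by blast
  then show ?thesis unfolding val2_ge_def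
    by (intro exI[of _ "a * a'"] exI[of _ "b * b'"]) (simp add: power_int_add)
qed

lemma val2_ge_mono:
  assumes "val2_ge q k" "l \<le> k"
  shows "val2_ge q l"
proof -
  obtain a b where ab: "odd b" "q = 2 powi k * of_int a / of_int b"
    using assms unfolding val2_ge_def by blast
  have "(2::rat) powi k = 2 powi l * 2 ^ nat (k - l)"
    using assms(2) power_int_add[of "2::rat" l "k - l"] by (simp add: power_int_def)
  then show ?thesis unfolding val2_ge_def
    using ab by (intro exI[of _ "2 ^ nat (k - l) * a"] exI[of _ b]) simp
qed

lemma val2_ge_add:
  assumes "val2_ge q k" "val2_ge r k"
  shows "val2_ge (q + r) k"
proof -
  obtain a b a' b' where "odd b" "q = 2 powi k * of_int a / of_int b"
    "odd b'" "r = 2 powi k * of_int a' / of_int b'"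
    using assms unfolding val2_ge_def by blast
  moreover from this have "of_int b \<noteq> (0::rat)" "of_int b' \<noteq> (0::rat)" by auto
  ultimately show ?thesis unfolding val2_ge_def
    by (intro exI[of _ "a * b' + a' * b"] exI[of _ "b * b'"]) (simp add: field_simps)
qed

lemma val2_ge_of_int: "val2_ge (of_int a) 0"
  unfolding val2_ge_def by (intro exI[of _ a] exI[of _ 1]) simp

lemma val2_ge_minus: "val2_ge q k \<Longrightarrow> val2_ge (- q) k"
  using val2_ge_mult[OF val2_ge_of_int[of "- 1"], of q k] by simp

lemma val2_ge_diff: "val2_ge q k \<Longrightarrow> val2_ge r k \<Longrightarrow> val2_ge (q - r) k"
  using val2_ge_add[of q k "- r"] val2_ge_minus[of r k] by simp

text \<open>After \<open>2 powi k\<close> is factored out, the common numerator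
  \<open>a * b' + 2 * a' * b\<close> is odd: the term of strictly smaller valuation
  dominates.\<close>

lemma val2_add:
  assumes "val2 q k" "val2_ge r l" "k < l"
  shows "val2 (q + r) k"
proof -
  have "val2_ge r (k + 1)" using assms val2_ge_mono by simp
  then obtain a b a' b' where *: "odd a" "odd b" "q = 2 powi k * of_int a / of_int b"
    "odd b'" "r = 2 powi (k + 1) * of_int a' / of_int b'"
    using assms unfolding val2_def val2_ge_def by blast
  moreover from * have "of_int b \<noteq> (0::rat)" "of_int b' \<noteq> (0::rat)" by auto
  ultimately show ?thesis unfolding val2_def
    by (intro exI[of _ "a * b' + 2 * a' * b"] exI[of _ "b * b'"])
       (simp add: power_int_add field_simps)
qed

lemma val2_diff: "val2 q k \<Longrightarrow> val2_ge r l \<Longrightarrow> k < l \<Longrightarrow> val2 (q - r) k"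
  using val2_add[of q k "- r" l] val2_ge_minus[of r l] by simp

lemma not_val2_zero: "\<not> val2 0 k"
  using val2_nonzero by blast

text \<open>If two valuations differed, dominance would give \<open>q - q = 0\<close> the smaller
  one.\<close>

lemma val2_unique:
  assumes "val2 q k" "val2 q l"
  shows "k = l"
proof (rule ccontr)
  assume "k \<noteq> l"
  then consider "k < l" | "l < k" by linarith
  then have "val2 (q - q) k \<or> val2 (q - q) l"
    using assms val2_diff val2_imp_ge by cases blast+
  then show False by (simp add: not_val2_zero)
qed

lemma val2_sqrt:
  assumes "val2 (q\<^sup>2) (2 * k)"
  shows "val2 q k"
proof -
  have "q \<noteq> 0" using val2_nonzero[OF assms] by auto
  then obtain l where l: "val2 q l" by (rule val2_exists)
  from val2_power[OF this, of 2] assms have "2 * l = 2 * k" by (metis of_nat_numeral val2_unique)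
  with l show ?thesis by simp
qed

lemma val2_ge_le:
  assumes "val2 q k" "val2_ge q l"
  shows "l \<le> k"
proof (rule ccontr)
  assume "\<not> l \<le> k"
  then have "val2 (q - q) k" using assms by (intro val2_diff) auto
  then show False by (simp add: not_val2_zero)
qed

lemma val2_0_half:
  assumes "val2 q 0"
  shows "val2_ge ((q - 1) / 2) 0"
proof -
  obtain a b where *: "odd a" "odd b" "q = of_int a / of_int b"
    using assms unfolding val2_def by auto
  then have "even (a - b)" by simp
  then obtain d where d: "a - b = 2 * d" by (rule evenE)
  have "of_int a - of_int b = (2 * of_int d :: rat)"
    using arg_cong[OF d, of "of_int :: int \<Rightarrow> rat"] by simp
  moreover have "of_int b \<noteq> (0::rat)" using * by auto
  ultimately show ?thesis unfolding val2_ge_def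
    using * by (intro exI[of _ d] exI[of _ b]) (simp add: field_simps)
qed

lemma val2_odd_fraction: "odd a \<Longrightarrow> val2 (of_int a / 2 ^ n) (- int n)"
  unfolding val2_def by (intro exI[of _ a] exI[of _ 1]) (simp add: power_int_minus field_simps)

section \<open>Points of infinite order\<close>

lemma elliptic_double:
  fixes X Y a b :: rat
  assumes "Y\<^sup>2 = X^3 + a * X\<^sup>2 + b * X" "Y \<noteq> 0"
  shows "\<exists>Y'. Y'\<^sup>2 = (((X\<^sup>2 - b) / (2 * Y))\<^sup>2)^3 + a * (((X\<^sup>2 - b) / (2 * Y))\<^sup>2)\<^sup>2
                 + b * ((X\<^sup>2 - b) / (2 * Y))\<^sup>2"
proof -
  define s where "s = (X\<^sup>2 - b) / (2 * Y)"
  \<comment> \<open>\<open>t\<close> is the slope of the tangent at \<open>(X, Y)\<close>. The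
    double has abscissa \<open>t^2 - a - 2 * X\<close>, which \<open>sum\<close> identifies with
    \<open>s^2\<close>, and ordinate \<open>t * (X - s^2) - Y\<close>.\<close>
  define t where "t = (3 * X\<^sup>2 + 2 * a * X + b) / (2 * Y)"
  have s: "2 * s * Y = X\<^sup>2 - b" and t: "2 * t * Y = 3 * X\<^sup>2 + 2 * a * X + b"
    using assms(2) by (simp_all add: s_def t_def)
  have sum: "s\<^sup>2 = t\<^sup>2 - a - 2 * X"
  proof -
    have "4 * Y\<^sup>2 * s\<^sup>2 = (X\<^sup>2 - b)\<^sup>2"
      unfolding s[symmetric] by (simp add: power_mult_distrib)
    also have "\<dots> = (3 * X\<^sup>2 + 2 * a * X + b)\<^sup>2 - 4 * Y\<^sup>2 * (a + 2 * X)"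
      unfolding assms(1) by (simp add: algebra_simps power2_eq_square power3_eq_cube)
    also have "\<dots> = 4 * Y\<^sup>2 * (t\<^sup>2 - a - 2 * X)"
      unfolding t[symmetric] by (simp add: power_mult_distrib algebra_simps)
    finally show ?thesis using assms(2) by simp
  qed
  have t2: "t\<^sup>2 = s\<^sup>2 + a + 2 * X" using sum by simp
  have "(t * (X - s\<^sup>2) - Y)\<^sup>2 = t\<^sup>2 * (X - s\<^sup>2)\<^sup>2 - 2 * t * Y * (X - s\<^sup>2) + Y\<^sup>2"
    by (simp add: algebra_simps power2_eq_square)
  also have "\<dots> = (s\<^sup>2)^3 + a * (s\<^sup>2)\<^sup>2 + b * s\<^sup>2"
    unfolding t t2 assms(1) by (simp add: algebra_simps power2_eq_square power3_eq_cube)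
  finally have "(t * (X - s\<^sup>2) - Y)\<^sup>2 = (s\<^sup>2)^3 + a * (s\<^sup>2)\<^sup>2 + b * s\<^sup>2" .
  then show ?thesis unfolding s_def by blast
qed

text \<open>The terms with \<open>a\<close> and \<open>b\<close> have valuations at least
  \<open>1 - 5 * n\<close> and \<open>1 - 3 * n\<close>, so \<open>X^3\<close> with
  \<open>- 6 * n\<close> dominates and \<open>Y\<close> gets half of that.\<close>

lemma val2_elliptic_Y:
  assumes "Y\<^sup>2 = X^3 + a * X\<^sup>2 + b * X" "val2 X (- 2 * n)" "n \<ge> 1"
    "val2_ge a (1 - n)" "val2_ge b (1 - n)"
  shows "val2 Y (- 3 * n)"
proof -
  have X3: "val2 (X^3) (- 6 * n)" and X2: "val2 (X\<^sup>2) (- 4 * n)"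
    using val2_power[OF assms(2), of 3] val2_power[OF assms(2), of 2] by simp_all
  have "val2_ge (a * X\<^sup>2) (1 - n + - 4 * n)" "val2_ge (b * X) (1 - n + - 2 * n)"
    using assms X2 by (blast intro: val2_ge_mult val2_imp_ge)+
  then have "val2 (X^3 + a * X\<^sup>2 + b * X) (- 6 * n)"
    by (intro val2_add[OF val2_add[OF X3]]) (use assms(3) in auto)
  then have "val2 (Y\<^sup>2) (2 * (- 3 * n))" by (simp add: assms(1))
  then show ?thesis by (rule val2_sqrt)
qed

text \<open>The root \<open>(X^2 - b) / (2 * Y)\<close> of the new abscissa has valuation
  \<open>- 4 * n - (1 - 3 * n) = - (n + 1)\<close>; the drop comes from the factor 2 in the
  denominator.\<close>

lemma elliptic_double_val2:
  assumes eq: "Y\<^sup>2 = X^3 + a * X\<^sup>2 + b * X" and X: "val2 X (- 2 * n)" and n: "n \<ge> 1"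
    and ab: "val2_ge a (1 - n)" "val2_ge b (1 - n)"
  shows "\<exists>X' Y'. Y'\<^sup>2 = X'^3 + a * X'\<^sup>2 + b * X' \<and> val2 X' (- 2 * (n + 1))"
proof -
  have Y: "val2 Y (- 3 * n)" by (rule val2_elliptic_Y[OF assms])
  have "val2 (X\<^sup>2) (- 4 * n)" using val2_power[OF X, of 2] by simp
  then have "val2 (X\<^sup>2 - b) (- 4 * n)" using ab(2) by (rule val2_diff) (use n in simp)
  moreover have "val2 (2 * Y) (1 - 3 * n)" using val2_mult[OF val2_two Y] by simp
  ultimately have "val2 (((X\<^sup>2 - b) / (2 * Y))\<^sup>2) (int 2 * (- 4 * n - (1 - 3 * n)))"
    by (intro val2_power val2_divide)
  moreover have "int 2 * (- 4 * n - (1 - 3 * n)) = - 2 * (n + 1)" by simp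
  ultimately have "val2 (((X\<^sup>2 - b) / (2 * Y))\<^sup>2) (- 2 * (n + 1))" by metis
  then show ?thesis using elliptic_double[OF eq val2_nonzero[OF Y]] by blast
qed

lemma infinite_elliptic:
  assumes "Y\<^sup>2 = X^3 + a * X\<^sup>2 + b * X" "val2 X (- 2 * N)" "N \<ge> 1"
    "val2_ge a (1 - N)" "val2_ge b (1 - N)"
  shows "infinite {X. \<exists>Y n. Y\<^sup>2 = X^3 + a * X\<^sup>2 + b * X \<and> val2 X (- 2 * n) \<and> n \<ge> N}"
    (is "infinite ?S")
proof -
  have "\<exists>X Y. Y\<^sup>2 = X^3 + a * X\<^sup>2 + b * X \<and> val2 X (- 2 * (N + int m))" for m
  proof (induction m)
    case 0
    then show ?case using assms by auto
  next
    case (Suc m)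
    then obtain X Y where XY: "Y\<^sup>2 = X^3 + a * X\<^sup>2 + b * X" "val2 X (- 2 * (N + int m))"
      by blast
    \<comment> \<open>The bounds on \<open>a\<close> and \<open>b\<close> only weaken as the
      valuation of \<open>X\<close> drops, so doubling can be repeated.\<close>
    have "val2_ge a (1 - (N + int m))" "val2_ge b (1 - (N + int m))"
      using assms(4,5) by (auto elim: val2_ge_mono)
    with elliptic_double_val2[OF XY] assms(3) show ?case by (simp add: algebra_simps)
  qed
  then have "\<exists>X. \<forall>m. \<exists>Y. Y\<^sup>2 = (X m)^3 + a * (X m)\<^sup>2 + b * X m \<and> val2 (X m) (- 2 * (N + int m))"
    by (intro choice) blast
  then obtain X where X: "\<And>m. \<exists>Y. Y\<^sup>2 = (X m)^3 + a * (X m)\<^sup>2 + b * X m"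
    "\<And>m. val2 (X m) (- 2 * (N + int m))"
    by blast
  have "inj X"
  proof (rule injI)
    fix i j assume "X i = X j"
    then have "- 2 * (N + int i) = - 2 * (N + int j)" using X(2) val2_unique by metis
    then show "i = j" by simp
  qed
  moreover have "range X \<subseteq> ?S"
  proof clarify
    fix m
    show "\<exists>Y n. Y\<^sup>2 = (X m)^3 + a * (X m)\<^sup>2 + b * X m \<and> val2 (X m) (- 2 * n) \<and> n \<ge> N"
      using X[of m] by (auto intro!: exI[of _ "N + int m"])
  qed
  ultimately show ?thesis using range_inj_infinite infinite_super by blast
qed

section \<open>Normalization\<close>

text \<open>Replacing \<open>X\<close> by \<open>(B / A) X\<close> turns \<open>f\<close> into \<open>B (X + 1 + e / X)\<close> with \<open>e = A C / B\<^sup>2\<close>.\<close>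

definition normalized_solutions :: "rat \<Rightarrow> (rat \<times> rat \<times> rat) set" where
  "normalized_solutions e =
     {(x, y, z). x \<noteq> 0 \<and> y \<noteq> 0 \<and> z \<noteq> 0 \<and>
        (x + 1 + e / x) * (y + 1 + e / y) = (z + 1 + e / z)\<^sup>2 \<and>
        x + 1 + e / x \<noteq> y + 1 + e / y \<and> z + 1 + e / z \<noteq> 0}"

lemma infinite_nontrivial_solutions_if_normalized:
  fixes A B C :: int
  assumes "A \<noteq> 0" "B \<noteq> 0"
    and inf: "infinite (normalized_solutions (of_int (A * C) / (of_int B)\<^sup>2))"
  shows "infinite (nontrivial_solutions A B C)"
proof -
  define e where "e = (of_int (A * C) / (of_int B)\<^sup>2 :: rat)"
  define r where "r = (of_int B / of_int A :: rat)"
  define \<phi> where "\<phi> = (\<lambda>(x, y, z). (r * x, r * y, r * z))"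
  have AB: "of_int A \<noteq> (0 :: rat)" "of_int B \<noteq> (0 :: rat)" using assms by auto
  then have r: "r \<noteq> 0" by (simp add: r_def)
  have f: "fABC A B C (r * x) = of_int B * (x + 1 + e / x)" for x
    using AB by (cases "x = 0") (auto simp: fABC_def r_def e_def power2_eq_square field_simps)
  have "inj \<phi>" using r by (auto simp: inj_def \<phi>_def)
  with inf have "infinite (\<phi> ` normalized_solutions e)"
    unfolding e_def by (meson finite_imageD inj_on_subset subset_UNIV)
  moreover have "\<phi> ` normalized_solutions e \<subseteq> nontrivial_solutions A B C"
  proof
    fix p assume "p \<in> \<phi> ` normalized_solutions e"
    then obtain x y z where p: "p = \<phi> (x, y, z)" and "(x, y, z) \<in> normalized_solutions e"
      by (metis imageE prod_cases3)
    then have *: "x \<noteq> 0" "y \<noteq> 0" "z \<noteq> 0"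
      "(x + 1 + e / x) * (y + 1 + e / y) = (z + 1 + e / z)\<^sup>2"
      "x + 1 + e / x \<noteq> y + 1 + e / y" "z + 1 + e / z \<noteq> 0"
      by (auto simp: normalized_solutions_def)
    have "fABC A B C (r * x) * fABC A B C (r * y) =
        (of_int B)\<^sup>2 * ((x + 1 + e / x) * (y + 1 + e / y))"
      unfolding f power2_eq_square by (simp only: mult_ac)
    also have "\<dots> = (fABC A B C (r * z))\<^sup>2" unfolding *(4) f power_mult_distrib ..
    finally show "p \<in> nontrivial_solutions A B C"
      using * r AB by (simp add: p \<phi>_def nontrivial_solutions_def f)
  qed
  ultimately show ?thesis using infinite_super by blast
qed

lemma normalized_value_eq_iff:
  fixes x y e :: rat
  assumes "x \<noteq> 0" "y \<noteq> 0"
  shows "x + 1 + e / x = y + 1 + e / y \<longleftrightarrow> x = y \<or> x * y = e"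
proof -
  have "x * y * ((x + 1 + e / x) - (y + 1 + e / y)) = (x - y) * (x * y - e)"
    using assms by (simp add: field_simps)
  then show ?thesis using assms by (metis eq_iff_diff_eq_0 mult_eq_0_iff)
qed

section \<open>Solutions in geometric progression\<close>

text \<open>Both sides have denominator \<open>k^2 * x^2\<close>, and the difference of the
  numerators contains the assumed quadratic as a factor.\<close>

lemma geometric_solution:
  fixes x k e :: rat
  assumes "x \<noteq> 0" "k \<noteq> 0" "k\<^sup>2 * x\<^sup>2 + e * (k + 1)\<^sup>2 * x + e = 0"
  shows "(x + 1 + e / x) * (k\<^sup>2 * x + 1 + e / (k\<^sup>2 * x)) = (k * x + 1 + e / (k * x))\<^sup>2"
proof -
  define g where "g = (\<lambda>t. t\<^sup>2 + t + e)"
  have g: "t + 1 + e / t = g t / t" if "t \<noteq> 0" for t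
    using that by (simp add: g_def power2_eq_square add_divide_distrib)
  have "g x * g (k\<^sup>2 * x) - (g (k * x))\<^sup>2 = (k - 1)\<^sup>2 * x * (k\<^sup>2 * x\<^sup>2 + e * (k + 1)\<^sup>2 * x + e)"
    by (simp add: g_def power2_eq_square algebra_simps)
  then have "g x * g (k\<^sup>2 * x) = (g (k * x))\<^sup>2" using assms(3) by simp
  then have "g x / x * (g (k\<^sup>2 * x) / (k\<^sup>2 * x)) = (g (k * x) / (k * x))\<^sup>2"
    using assms(1,2) by (simp add: power_divide power2_eq_square mult_ac)
  then show ?thesis using assms(1,2) by (simp add: g)
qed

text \<open>The valuations \<open>- n\<close> of \<open>k\<close>, \<open>2 * n\<close> of
  \<open>x\<close> and \<open>n\<close> of \<open>k * x\<close> rule out every degenerate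
  case.\<close>

lemma elliptic_point_gives_solution:
  fixes X Y c :: rat
  assumes eq: "Y\<^sup>2 = X^3 + (- c) * X\<^sup>2 + c * X" and X: "val2 X (- 2 * n)" and n: "n \<ge> 1"
    and cn: "val2_ge c (1 - n)" and c: "c \<noteq> 0"
  defines "k \<equiv> (X + Y) / (c - X)" and "x \<equiv> - 1 / X"
  shows "(x, k\<^sup>2 * x, k * x) \<in> normalized_solutions (1 / c)"
proof -
  obtain j where j: "val2 c j" using c by (rule val2_exists)
  have jn: "1 - n \<le> j" by (rule val2_ge_le[OF j cn])
  have Y: "val2 Y (- 3 * n)"
    by (rule val2_elliptic_Y[OF eq X n val2_ge_minus[OF cn] cn])
  have "val2 (Y + X) (- 3 * n)"
    by (rule val2_add[OF Y val2_imp_ge[OF X]]) (use n in simp)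
  moreover have "val2 (- (X - c)) (- 2 * n)"
    by (intro val2_minus val2_diff[OF X cn]) (use n in simp)
  ultimately have kval: "val2 k (- n)"
    unfolding k_def using val2_divide[of "Y + X" "- 3 * n" "- (X - c)" "- 2 * n"]
    by (simp add: add.commute)
  have xval: "val2 x (2 * n)"
    unfolding x_def using val2_divide[OF val2_minus[OF val2_one] X] by simp
  have zval: "val2 (k * x) n" using val2_mult[OF kval xval] by simp
  have eval: "val2 (1 / c) (- j)" using val2_divide[OF val2_one j] by simp
  have X0: "X \<noteq> 0" "x \<noteq> 0" "k \<noteq> 0" using X xval kval val2_nonzero by auto
  then have cX: "c - X \<noteq> 0" by (auto simp: k_def)
  have k: "k * (c - X) = X + Y" using cX by (simp add: k_def)
  \<comment> \<open>Multiplied by \<open>c - X\<close>, the quadratic in \<open>k\<close> becomes a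
    polynomial in \<open>k * (c - X) = X + Y\<close>, which reduces it to the cubic
    equation.\<close>
  have "(c - X) * (c * k\<^sup>2 - (k + 1)\<^sup>2 * X + X\<^sup>2)
      = (k * (c - X))\<^sup>2 - 2 * X * (k * (c - X)) + (X\<^sup>2 - X) * (c - X)"
    by (simp add: algebra_simps power2_eq_square)
  also have "\<dots> = Y\<^sup>2 - (X^3 + (- c) * X\<^sup>2 + c * X)"
    unfolding k by (simp add: algebra_simps power2_eq_square power3_eq_cube)
  also have "\<dots> = 0" using eq by simp
  finally have "c * k\<^sup>2 - (k + 1)\<^sup>2 * X + X\<^sup>2 = 0" using cX by simp
  then have "(c * k\<^sup>2 - (k + 1)\<^sup>2 * X + X\<^sup>2) / (c * X\<^sup>2) = 0" by simp
  moreover have "(c * k\<^sup>2 - (k + 1)\<^sup>2 * X + X\<^sup>2) / (c * X\<^sup>2)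
      = k\<^sup>2 * x\<^sup>2 + 1 / c * (k + 1)\<^sup>2 * x + 1 / c"
    using X0(1) c by (simp add: x_def field_simps power2_eq_square)
  ultimately have "k\<^sup>2 * x\<^sup>2 + 1 / c * (k + 1)\<^sup>2 * x + 1 / c = 0" by simp
  from geometric_solution[OF X0(2,3) this]
  have main: "(x + 1 + (1 / c) / x) * (k\<^sup>2 * x + 1 + (1 / c) / (k\<^sup>2 * x))
      = (k * x + 1 + (1 / c) / (k * x))\<^sup>2" .
  have "k\<^sup>2 \<noteq> 1"
  proof
    assume "k\<^sup>2 = 1"
    then have "val2 1 (- 2 * n)" using val2_power[OF kval, of 2] by simp
    then show False using val2_unique[OF val2_one] n by fastforce
  qed
  then have "x \<noteq> k\<^sup>2 * x" using X0 by simp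
  \<comment> \<open>Equality would force \<open>- j = 2 * n\<close>, against
    \<open>- j \<le> n - 1\<close>.\<close>
  moreover have "x * (k\<^sup>2 * x) \<noteq> 1 / c"
  proof
    assume "x * (k\<^sup>2 * x) = 1 / c"
    then have "(k * x)\<^sup>2 = 1 / c" by (simp add: power2_eq_square mult_ac)
    then have "val2 (1 / c) (2 * n)" using val2_power[OF zval, of 2] by simp
    then show False using val2_unique[OF eval] jn n by fastforce
  qed
  ultimately have ne: "x + 1 + (1 / c) / x \<noteq> k\<^sup>2 * x + 1 + (1 / c) / (k\<^sup>2 * x)"
    using normalized_value_eq_iff[of x "k\<^sup>2 * x" "1 / c"] X0 by simp
  \<comment> \<open>Multiplied by \<open>k * x\<close>, the value at \<open>k * x\<close> is
    dominated by \<open>1 / c\<close>, whose valuation \<open>- j\<close> is at most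
    \<open>n - 1\<close>.\<close>
  have "val2 ((k * x)\<^sup>2) (2 * n)" using val2_power[OF zval, of 2] by simp
  then have "val2_ge (k * x + (k * x)\<^sup>2) n"
    using n zval by (intro val2_ge_add) (auto intro: val2_imp_ge val2_ge_mono)
  then have "val2 (1 / c + (k * x + (k * x)\<^sup>2)) (- j)"
    by (rule val2_add[OF eval]) (use jn in simp)
  then have "1 / c + (k * x + (k * x)\<^sup>2) \<noteq> 0" by (rule val2_nonzero)
  moreover have "k * x * (k * x + 1 + (1 / c) / (k * x)) = 1 / c + (k * x + (k * x)\<^sup>2)"
    using X0 by (simp add: power2_eq_square distrib_left)
  ultimately have "k * x + 1 + (1 / c) / (k * x) \<noteq> 0" by (metis mult_zero_right)
  then show ?thesis using main ne X0 by (simp add: normalized_solutions_def)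
qed

text \<open>With \<open>P = (1, 1)\<close> and \<open>h = (c - 1) / 2\<close> the point is \<open>2 P\<close>, with \<open>X = h\<^sup>2\<close>, if \<open>c\<close> is not a
  2-adic unit, \<open>4 P\<close> if \<open>h\<close> is even, and \<open>3 P\<close> if \<open>h\<close> is odd.\<close>

lemma elliptic_starting_point:
  fixes c :: rat
  assumes c: "c \<noteq> 0" "c \<noteq> 1" "c \<noteq> 3" "c \<noteq> - 1"
  shows "\<exists>X Y n. Y\<^sup>2 = X^3 + (- c) * X\<^sup>2 + c * X \<and> val2 X (- 2 * n) \<and> n \<ge> 1 \<and> val2_ge c (1 - n)"
proof -
  define h where "h = (c - 1) / 2"
  have ch: "c = 2 * h + 1" by (simp add: h_def field_simps)
  have h0: "h \<noteq> 0" "h \<noteq> 1" "h \<noteq> - 1" using c ch by auto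
  \<comment> \<open>These are the coordinates of \<open>2 P\<close>; the tangent at \<open>P\<close>
    has slope \<open>1 - h\<close>.\<close>
  have double: "(h * (h\<^sup>2 - h - 1))\<^sup>2 = (h\<^sup>2)^3 + (- c) * (h\<^sup>2)\<^sup>2 + c * h\<^sup>2"
    unfolding ch by (simp add: algebra_simps power2_eq_square power3_eq_cube)
  have square: "val2 (q\<^sup>2) (- 2 * n)" if "val2 q (- n)" for q n
    using val2_power[OF that, of 2] by simp
  obtain j where j: "val2 c j" using c(1) by (rule val2_exists)
  consider "j < 0" | "j > 0" | "j = 0" by linarith
  then show ?thesis
  proof cases
    case 1
    \<comment> \<open>Here \<open>h\<close> has valuation \<open>j - 1\<close>, so
      \<open>n = 1 - j\<close>, and the bound \<open>1 - n = j\<close> is exactly the valuation of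
      \<open>c\<close>.\<close>
    have "val2 (c - 1) j" using j val2_imp_ge[OF val2_one] 1 by (rule val2_diff)
    from val2_divide[OF this val2_two] have "val2 h (- (1 - j))" by (simp add: h_def)
    then have "val2 (h\<^sup>2) (- 2 * (1 - j))" by (rule square)
    then show ?thesis using double 1 val2_imp_ge[OF j]
      by (intro exI[of _ "h\<^sup>2"] exI[of _ "h * (h\<^sup>2 - h - 1)"] exI[of _ "1 - j"]) simp
  next
    case 2
    have "val2 (- (1 - c)) 0" by (intro val2_minus val2_diff[OF val2_one val2_imp_ge[OF j] 2])
    from val2_divide[OF this val2_two] have "val2 h (- 1)" by (simp add: h_def)
    then have "val2 (h\<^sup>2) (- 2 * 1)" by (rule square)
    moreover have "val2_ge c (1 - 1)" using val2_ge_mono[OF val2_imp_ge[OF j]] 2 by simp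
    ultimately show ?thesis using double
      by (intro exI[of _ "h\<^sup>2"] exI[of _ "h * (h\<^sup>2 - h - 1)"] exI[of _ 1]) simp
  next
    case 3
    then have cge: "val2_ge c 0" using j val2_imp_ge by simp
    have hge: "val2_ge h 0" unfolding h_def using j 3 by (intro val2_0_half) simp
    obtain m where m: "val2 h m" using h0(1) by (rule val2_exists)
    have m0: "m \<ge> 0" using val2_ge_le[OF m hge] .
    show ?thesis
    proof (cases "m = 0")
      case False
      with m0 have m1: "m \<ge> 1" by simp
      \<comment> \<open>\<open>2 P\<close> is doubled: \<open>h^2 - h - 1\<close> and
        \<open>h^4 - c\<close> are 2-adic units, so only the denominator \<open>2 * Y\<close>, of
        valuation \<open>1 + m\<close>, counts.\<close>
      define Y where "Y = h * (h\<^sup>2 - h - 1)"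
      have h2: "val2_ge (h\<^sup>2) (2 * m)" "val2_ge (h^4) (4 * m)"
        using val2_power[OF m, of 2] val2_power[OF m, of 4] val2_imp_ge by auto
      have "val2_ge (h\<^sup>2 - h) m"
        using h2(1) m m1 by (intro val2_ge_diff) (auto intro: val2_imp_ge val2_ge_mono)
      then have "val2 (- (1 - (h\<^sup>2 - h))) 0"
        using m1 by (intro val2_minus val2_diff[OF val2_one]) auto
      from val2_mult[OF m this] have "val2 Y m" by (simp add: Y_def)
      then have Y: "Y \<noteq> 0" "val2 (2 * Y) (1 + m)"
        using val2_nonzero val2_mult[OF val2_two] by auto
      have "val2 (- (c - h^4)) 0"
        using m1 j 3 by (intro val2_minus val2_diff[OF _ h2(2)]) auto
      then have "val2 ((h\<^sup>2)\<^sup>2 - c) 0" by simp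
      from val2_divide[OF this Y(2)] have "val2 (((h\<^sup>2)\<^sup>2 - c) / (2 * Y)) (- (1 + m))" by simp
      then have "val2 ((((h\<^sup>2)\<^sup>2 - c) / (2 * Y))\<^sup>2) (- 2 * (1 + m))" by (rule square)
      moreover have "val2_ge c (1 - (1 + m))" using val2_ge_mono[OF cge] m1 by simp
      moreover have "Y\<^sup>2 = (h\<^sup>2)^3 + (- c) * (h\<^sup>2)\<^sup>2 + c * h\<^sup>2"
        using double unfolding Y_def .
      moreover have "1 + m \<ge> 1" using m0 by simp
      ultimately show ?thesis using elliptic_double[OF _ Y(1)] by blast
    next
      case True
      define g where "g = (h - 1) / 2"
      have hg: "h = 1 + 2 * g" by (simp add: g_def field_simps)
      have g0: "g \<noteq> 0" "1 + g \<noteq> 0" using h0 hg by auto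
      have gge: "val2_ge g 0" unfolding g_def using m True by (intro val2_0_half) simp
      define u where "u = 2 * g * (1 + g)"
      have u0: "u \<noteq> 0" using g0 by (simp add: u_def)
      have "val2_ge u (1 + 0 + 0)"
        unfolding u_def using gge val2_imp_ge[OF val2_one] val2_imp_ge[OF val2_two]
        by (intro val2_ge_mult val2_ge_add) auto
      moreover obtain l where l: "val2 u l" using u0 by (rule val2_exists)
      ultimately have l1: "l \<ge> 1" using val2_ge_le by fastforce
      \<comment> \<open>\<open>t\<close> is the slope of the chord through \<open>P\<close> and
        \<open>2 P\<close>, whose abscissas differ by \<open>h^2 - 1 = 2 * u\<close>. The chord
        meets the curve again in \<open>- 3 P\<close>, with coordinates \<open>X\<close> and
        \<open>1 + t * (X - 1)\<close>.\<close>
      define t where "t = (2 * g * u - 1) / u"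
      define X where "X = t\<^sup>2 + 1 - 4 * g\<^sup>2"
      have tu: "t * u = 2 * g * u - 1" using u0 by (simp add: t_def)
      have "val2_ge (2 * g * u) 1"
        using val2_ge_mult[OF val2_ge_mult[OF val2_imp_ge[OF val2_two] gge] val2_imp_ge[OF l]] l1
        by (auto elim: val2_ge_mono)
      then have "val2 (- (1 - 2 * g * u)) 0"
        by (intro val2_minus val2_diff[OF val2_one]) auto
      from val2_divide[OF this l] have "val2 t (- l)" by (simp add: t_def)
      then have t2: "val2 (t\<^sup>2) (- 2 * l)" by (rule square)
      have g2: "val2_ge (2 * g) 0" using val2_ge_mult[OF val2_ge_of_int[of 2] gge] by simp
      have "val2_ge (1 - 2 * g * (2 * g)) 0"
        using val2_ge_diff[OF val2_imp_ge[OF val2_one]] val2_ge_mult[OF g2 g2] by simp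
      then have "val2 (t\<^sup>2 + (1 - 2 * g * (2 * g))) (- 2 * l)"
        by (rule val2_add[OF t2]) (use l1 in simp)
      moreover have "X = t\<^sup>2 + (1 - 2 * g * (2 * g))" by (simp add: X_def power2_eq_square)
      ultimately have "val2 X (- 2 * l)" by simp
      moreover have "(1 + t * (X - 1))\<^sup>2 = X^3 + (- c) * X\<^sup>2 + c * X"
      proof -
        have cg: "c = 3 + 4 * g" using ch hg by simp
        have "X^3 + (- c) * X\<^sup>2 + c * X - (1 + t * (X - 1))\<^sup>2
            = - 2 * (t\<^sup>2 - 4 * g\<^sup>2) * (t + 2 * g) * (u * t - 2 * g * u + 1)"
          unfolding X_def cg u_def by (simp add: algebra_simps power2_eq_square power3_eq_cube)
        also have "u * t - 2 * g * u + 1 = 0" using tu by (simp add: algebra_simps)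
        finally show ?thesis by simp
      qed
      moreover have "val2_ge c (1 - l)" using val2_ge_mono[OF cge] l1 by simp
      ultimately show ?thesis using l1 by blast
    qed
  qed
qed

text \<open>Distinct \<open>X\<close> give distinct solutions, since \<open>X = - 1 / x\<close> is
  recovered from the first component.\<close>

lemma infinite_normalized_solutions_generic:
  fixes c :: rat
  assumes c: "c \<noteq> 0" "c \<noteq> 1" "c \<noteq> 3" "c \<noteq> - 1"
  shows "infinite (normalized_solutions (1 / c))"
proof
  assume fin: "finite (normalized_solutions (1 / c))"
  obtain X0 Y0 N where start: "Y0\<^sup>2 = X0^3 + (- c) * X0\<^sup>2 + c * X0" "val2 X0 (- 2 * N)"
    "N \<ge> 1" "val2_ge c (1 - N)"
    using elliptic_starting_point[OF c] by blast
  define S where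
    "S = {X. \<exists>Y n. Y\<^sup>2 = X^3 + (- c) * X\<^sup>2 + c * X \<and> val2 X (- 2 * n) \<and> n \<ge> N}"
  have "infinite S"
    unfolding S_def by (rule infinite_elliptic[OF start(1-3) val2_ge_minus[OF start(4)] start(4)])
  moreover have "S \<subseteq> (\<lambda>(x, y, z). - 1 / x) ` normalized_solutions (1 / c)"
  proof
    fix X assume "X \<in> S"
    then obtain Y n where *: "Y\<^sup>2 = X^3 + (- c) * X\<^sup>2 + c * X" "val2 X (- 2 * n)" "n \<ge> N"
      unfolding S_def by blast
    have "val2_ge c (1 - n)" using start(4) *(3) by (auto elim: val2_ge_mono)
    from elliptic_point_gives_solution[OF *(1,2) _ this c(1)] start(3) *(3)
    show "X \<in> (\<lambda>(x, y, z). - 1 / x) ` normalized_solutions (1 / c)"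
      by (force simp: image_iff)
  qed
  ultimately show False using fin finite_surj by blast
qed

section \<open>Solutions with fixed \<open>z\<close>\<close>

text \<open>For fixed \<open>z\<close> the equation is a conic in \<open>\<sigma> = x + y\<close> and \<open>\<pi> = x y\<close> through \<open>(2 z, z\<^sup>2)\<close>.
  The line of slope \<open>T\<close> through that point yields rational \<open>x\<close>, \<open>y\<close> iff \<open>\<sigma>\<^sup>2 - 4 \<pi>\<close> is a
  square, and \<open>\<rho> = 1 / (L1 T + L0)\<close> brings this condition into cubic form.\<close>

lemma finite_poly_roots:
  fixes p :: "'a::idom poly"
  assumes "p \<noteq> 0" "\<And>T. f T = poly p T"
  shows "finite {T. f T = 0}"
  using poly_roots_finite[OF assms(1)] assms(2) by simp

lemma infinite_normalized_solutions_fibre: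
  fixes e z L0 L1 :: rat
  assumes e: "e \<noteq> 0" and z: "z \<noteq> 0" "z\<^sup>2 \<noteq> e" "z + 1 + e / z \<noteq> 0"
    and L1: "L1 = 2 * z\<^sup>2 + 2 * z + 1 - 2 * e - (z + 1 + e / z)\<^sup>2" "L1 \<noteq> 0"
    and L0: "L0 = z\<^sup>2 + 4 * e * z + e"
    and inf: "infinite {\<rho>. \<exists>W. W\<^sup>2 = \<rho>\<^sup>2 + 4 / L1^3 * (1 - (L0 + z * L1) * \<rho>) *
      ((L0\<^sup>2 - L0 * L1 + e * L1\<^sup>2) * \<rho>\<^sup>2 + (L1 - 2 * L0) * \<rho> + 1)}" (is "infinite ?R")
  shows "infinite (normalized_solutions e)"
proof
  assume fin: "finite (normalized_solutions e)"
  define M where "M = (z + 1 + e / z)\<^sup>2"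
  \<comment> \<open>The line of slope \<open>T\<close> meets the conic again at
    \<open>(2 * z + S, z^2 + T * S)\<close> with \<open>S = - \<tau> T / g T\<close>; there the
    discriminant of \<open>x\<close> and \<open>y\<close> is
    \<open>\<tau> T * K T / (g T)^2\<close>.\<close>
  define g where "g = (\<lambda>T. T\<^sup>2 + T + e)"
  define \<tau> where "\<tau> = (\<lambda>T. L1 * T + L0)"
  define K where "K = (\<lambda>T. \<tau> T + 4 * (T - z) * g T)"
  have L1M: "L1 = 2 * z\<^sup>2 + 2 * z + 1 - 2 * e - M" by (simp add: L1(1) M_def)
  have Mz: "(g z)\<^sup>2 = M * z\<^sup>2"
  proof -
    have "g z = z * (z + 1 + e / z)" using z(1) by (simp add: g_def power2_eq_square distrib_left)
    then show ?thesis by (simp add: M_def power_mult_distrib)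
  qed
  define \<T> where "\<T> = {T. \<exists>D. D\<^sup>2 = \<tau> T * K T}"
  \<comment> \<open>The degenerate slopes: asymptotic direction, return to the base point,
    \<open>x = y\<close>, \<open>x * y = 0\<close> and \<open>x * y = e\<close>, in this
    order.\<close>
  define \<B> where "\<B> = {T. g T = 0} \<union> {T. \<tau> T = 0} \<union> {T. K T = 0} \<union>
    {T. z\<^sup>2 * g T - T * \<tau> T = 0} \<union> {T. (z\<^sup>2 - e) * g T - T * \<tau> T = 0}"
  have "infinite ((\<lambda>\<rho>. (1 / \<rho> - L0) / L1) ` (?R - {0}))"
  proof
    assume "finite ((\<lambda>\<rho>. (1 / \<rho> - L0) / L1) ` (?R - {0}))"
    moreover have "inj_on (\<lambda>\<rho>. (1 / \<rho> - L0) / L1) (?R - {0})"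
      using L1(2) by (auto simp: inj_on_def)
    ultimately have "finite (?R - {0})" by (rule finite_imageD)
    then show False using inf by simp
  qed
  moreover have "(\<lambda>\<rho>. (1 / \<rho> - L0) / L1) ` (?R - {0}) \<subseteq> \<T>"
  proof
    fix t assume "t \<in> (\<lambda>\<rho>. (1 / \<rho> - L0) / L1) ` (?R - {0})"
    then obtain \<rho> W where t: "t = (1 / \<rho> - L0) / L1" and \<rho>: "\<rho> \<noteq> 0"
      and W: "W\<^sup>2 = \<rho>\<^sup>2 + 4 / L1^3 * (1 - (L0 + z * L1) * \<rho>) *
      ((L0\<^sup>2 - L0 * L1 + e * L1\<^sup>2) * \<rho>\<^sup>2 + (L1 - 2 * L0) * \<rho> + 1)"
      by auto
    define T where "T = (1 / \<rho> - L0) / L1"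
    have \<tau>\<rho>: "\<tau> T * \<rho> = 1" using \<rho> L1(2) by (simp add: \<tau>_def T_def)
    have Tz: "1 - (L0 + z * L1) * \<rho> = L1 * \<rho> * (T - z)"
      using \<rho> L1(2) by (simp add: T_def field_simps)
    have gT: "(L0\<^sup>2 - L0 * L1 + e * L1\<^sup>2) * \<rho>\<^sup>2 + (L1 - 2 * L0) * \<rho> + 1 = L1\<^sup>2 * \<rho>\<^sup>2 * g T"
      using \<rho> L1(2) by (simp add: T_def g_def field_simps power2_eq_square)
    have W2: "W\<^sup>2 = \<rho>\<^sup>2 + 4 * \<rho>^3 * (T - z) * g T"
      unfolding W Tz gT using L1(2) by (simp add: power2_eq_square power3_eq_cube)
    \<comment> \<open>Since \<open>\<tau> T * \<rho> = 1\<close>, clearing \<open>\<rho>\<close>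
      with a fourth power of \<open>\<tau> T\<close> turns the cubic condition into the discriminant
      condition.\<close>
    have "(W * (\<tau> T)\<^sup>2)\<^sup>2 = W\<^sup>2 * ((\<tau> T)\<^sup>2)\<^sup>2"
      by (simp only: power_mult_distrib)
    also have "\<dots> = (\<tau> T * \<rho>)\<^sup>2 * (\<tau> T)\<^sup>2 + 4 * (\<tau> T * \<rho>)^3 * \<tau> T * (T - z) * g T"
      unfolding W2 by (simp add: algebra_simps power2_eq_square power3_eq_cube)
    also have "\<dots> = \<tau> T * K T"
      unfolding \<tau>\<rho> by (simp add: K_def algebra_simps power2_eq_square)
    finally have "(W * (\<tau> T)\<^sup>2)\<^sup>2 = \<tau> T * K T" .
    then show "t \<in> \<T>" unfolding \<T>_def T_def t by blast
  qed
  ultimately have "infinite \<T>" using infinite_super by blast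
  moreover have "finite \<B>"
  proof -
    \<comment> \<open>The first three polynomials have leading coefficients 1, \<open>L1\<close> and
      4; the last two have the nonzero constant terms \<open>z^2 * e\<close> and
      \<open>(z^2 - e) * e\<close>.\<close>
    have "finite {T. g T = 0}"
      by (rule finite_poly_roots[of "[:e, 1, 1:]"]) (auto simp: g_def algebra_simps power2_eq_square)
    moreover have "finite {T. \<tau> T = 0}"
      by (rule finite_poly_roots[of "[:L0, L1:]"]) (use L1(2) in \<open>auto simp: \<tau>_def\<close>)
    moreover have "finite {T. K T = 0}"
      by (rule finite_poly_roots[of "[:L0 - 4 * z * e, L1 + 4 * e - 4 * z, 4 - 4 * z, 4:]"])
        (auto simp: K_def \<tau>_def g_def algebra_simps power2_eq_square)
    moreover have "finite {T. z\<^sup>2 * g T - T * \<tau> T = 0}"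
      by (rule finite_poly_roots[of "[:z\<^sup>2 * e, z\<^sup>2 - L0, z\<^sup>2 - L1:]"])
        (use z e in \<open>auto simp: \<tau>_def g_def algebra_simps power2_eq_square\<close>)
    moreover have "finite {T. (z\<^sup>2 - e) * g T - T * \<tau> T = 0}"
      by (rule finite_poly_roots[of "[:(z\<^sup>2 - e) * e, (z\<^sup>2 - e) - L0, (z\<^sup>2 - e) - L1:]"])
        (use z e in \<open>auto simp: \<tau>_def g_def algebra_simps power2_eq_square\<close>)
    ultimately show ?thesis unfolding \<B>_def by blast
  qed
  ultimately have "infinite (\<T> - \<B>)" by (rule Diff_infinite_finite[rotated])
  \<comment> \<open>The slope is recovered from the solution, so distinct slopes give distinct
    solutions.\<close>
  moreover have "\<T> - \<B> \<subseteq> (\<lambda>(x, y, w). (x * y - w\<^sup>2) / (x + y - 2 * w)) ` normalized_solutions e"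
  proof
    fix T assume "T \<in> \<T> - \<B>"
    then obtain D where D: "D\<^sup>2 = \<tau> T * K T" and gT: "g T \<noteq> 0" and \<tau>T: "\<tau> T \<noteq> 0"
      and KT: "K T \<noteq> 0" and pT: "z\<^sup>2 * g T - T * \<tau> T \<noteq> 0" "(z\<^sup>2 - e) * g T - T * \<tau> T \<noteq> 0"
      unfolding \<T>_def \<B>_def by blast
    define S where "S = - \<tau> T / g T"
    define d where "d = D / g T"
    define x where "x = (2 * z + S + d) / 2"
    define y where "y = (2 * z + S - d) / 2"
    have S: "S * g T = - \<tau> T" "S \<noteq> 0" using gT \<tau>T by (simp_all add: S_def)
    have "d\<^sup>2 * (g T)\<^sup>2 = S\<^sup>2 * (g T)\<^sup>2 - 4 * S * (T - z) * (g T)\<^sup>2"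
    proof -
      have "d\<^sup>2 * (g T)\<^sup>2 = \<tau> T * K T" using gT by (simp add: d_def power_divide D)
      also have "\<dots> = (S * g T)\<^sup>2 - 4 * (S * g T) * (T - z) * g T"
        unfolding S(1) K_def by (simp add: algebra_simps power2_eq_square)
      finally show ?thesis by (simp add: power2_eq_square algebra_simps)
    qed
    then have "d\<^sup>2 * (g T)\<^sup>2 = (S\<^sup>2 - 4 * S * (T - z)) * (g T)\<^sup>2"
      by (simp add: algebra_simps)
    then have d: "d\<^sup>2 = S\<^sup>2 - 4 * S * (T - z)" using gT by simp
    have sum: "x + y = 2 * z + S" by (simp add: x_def y_def field_simps)
    have "4 * (x * y) = (2 * z + S)\<^sup>2 - d\<^sup>2"
      by (simp add: x_def y_def field_simps power2_eq_square)
    then have prod: "x * y = z\<^sup>2 + T * S"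
      unfolding d by (simp add: algebra_simps power2_eq_square)
    have "(x * y) * g T = z\<^sup>2 * g T + T * (S * g T)"
      unfolding prod by (simp add: algebra_simps)
    then have pg: "(x * y) * g T = z\<^sup>2 * g T - T * \<tau> T" by (simp add: S(1))
    then have xy: "x * y \<noteq> 0" using pT(1) by auto
    have xye: "x * y \<noteq> e"
      using pT(2) pg by (auto simp: algebra_simps)
    have "D \<noteq> 0" using D \<tau>T KT by auto
    then have "x \<noteq> y" using gT by (simp add: x_def y_def d_def)
    have "g x * g y = (x * y)\<^sup>2 + (x * y) * (x + y) + e * ((x + y)\<^sup>2 - 2 * (x * y))
        + x * y + e * (x + y) + e\<^sup>2"
      by (simp add: g_def algebra_simps power2_eq_square)
    \<comment> \<open>On the line, the conic equation has no constant term in \<open>S\<close> by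
      \<open>Mz\<close>, and its linear coefficient is \<open>L1 * T + L0\<close>; this is the
      origin of \<open>L0\<close> and \<open>L1\<close>.\<close>
    also have "\<dots> = M * (x * y) + (S * (S * g T + \<tau> T) + ((g z)\<^sup>2 - M * z\<^sup>2))"
      unfolding prod sum by (simp add: g_def \<tau>_def L0 L1M algebra_simps power2_eq_square)
    also have "\<dots> = M * (x * y)" using S(1) Mz by simp
    finally have "g x * g y = M * (x * y)" .
    moreover have "(x + 1 + e / x) * (y + 1 + e / y) = g x * g y / (x * y)"
      using xy by (simp add: g_def field_simps power2_eq_square)
    ultimately have "(x + 1 + e / x) * (y + 1 + e / y) = (z + 1 + e / z)\<^sup>2"
      using xy by (simp add: M_def)
    moreover have "x + 1 + e / x \<noteq> y + 1 + e / y"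
      using normalized_value_eq_iff[of x y e] xy xye \<open>x \<noteq> y\<close> by auto
    ultimately have "(x, y, z) \<in> normalized_solutions e"
      using xy z by (simp add: normalized_solutions_def)
    moreover have "T = (x * y - z\<^sup>2) / (x + y - 2 * z)"
      unfolding sum prod using S(2) by simp
    ultimately show "T \<in> (\<lambda>(x, y, w). (x * y - w\<^sup>2) / (x + y - 2 * w)) ` normalized_solutions e"
      by (auto simp: image_iff intro!: bexI[of _ "(x, y, z)"])
  qed
  ultimately show False using fin finite_surj by blast
qed

text \<open>The substitution \<open>\<rho> = (l * X + R) / Q\<close>, \<open>W = Y / Q\<close>
  passes to a model with 2-integral coefficients, where doubling from \<open>(X0, Y0)\<close> yields
  infinitely many points.\<close>

lemma infinite_normalized_solutions_elliptic_fibre: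
  fixes e z L0 L1 a b X0 Y0 l R Q :: rat
  assumes "e \<noteq> 0" "z \<noteq> 0" "z\<^sup>2 \<noteq> e" "z + 1 + e / z \<noteq> 0"
    and "L1 = 2 * z\<^sup>2 + 2 * z + 1 - 2 * e - (z + 1 + e / z)\<^sup>2" "L1 \<noteq> 0"
    and "L0 = z\<^sup>2 + 4 * e * z + e"
    and start: "Y0\<^sup>2 = X0^3 + a * X0\<^sup>2 + b * X0" "val2 X0 (- 2 * N)" "N \<ge> 1"
    and ab: "val2_ge a 0" "val2_ge b 0"
    and "l \<noteq> 0" "Q \<noteq> 0"
    and model: "\<And>X. X^3 + a * X\<^sup>2 + b * X = Q\<^sup>2 * (((l * X + R) / Q)\<^sup>2
        + 4 / L1^3 * (1 - (L0 + z * L1) * ((l * X + R) / Q)) *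
          ((L0\<^sup>2 - L0 * L1 + e * L1\<^sup>2) * ((l * X + R) / Q)\<^sup>2
            + (L1 - 2 * L0) * ((l * X + R) / Q) + 1))"
  shows "infinite (normalized_solutions e)"
proof (rule infinite_normalized_solutions_fibre[OF assms(1-7)])
  have ab': "val2_ge a (1 - N)" "val2_ge b (1 - N)"
    using ab start(3) by (auto elim: val2_ge_mono)
  define S where "S = {X. \<exists>Y n. Y\<^sup>2 = X^3 + a * X\<^sup>2 + b * X \<and> val2 X (- 2 * n) \<and> n \<ge> N}"
  have "infinite S" unfolding S_def by (rule infinite_elliptic[OF start ab'])
  moreover have "inj_on (\<lambda>X. (l * X + R) / Q) S"
    using \<open>l \<noteq> 0\<close> \<open>Q \<noteq> 0\<close> by (auto simp: inj_on_def)
  ultimately have "infinite ((\<lambda>X. (l * X + R) / Q) ` S)" using finite_imageD by blast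
  moreover have "(\<lambda>X. (l * X + R) / Q) ` S \<subseteq> {\<rho>. \<exists>W. W\<^sup>2 = \<rho>\<^sup>2
      + 4 / L1^3 * (1 - (L0 + z * L1) * \<rho>) *
      ((L0\<^sup>2 - L0 * L1 + e * L1\<^sup>2) * \<rho>\<^sup>2 + (L1 - 2 * L0) * \<rho> + 1)}" (is "_ \<subseteq> ?R")
  proof
    fix \<rho> assume "\<rho> \<in> (\<lambda>X. (l * X + R) / Q) ` S"
    then obtain X Y where \<rho>: "\<rho> = (l * X + R) / Q" and Y: "Y\<^sup>2 = X^3 + a * X\<^sup>2 + b * X"
      unfolding S_def by blast
    have "(Y / Q)\<^sup>2 = \<rho>\<^sup>2 + 4 / L1^3 * (1 - (L0 + z * L1) * \<rho>) *
      ((L0\<^sup>2 - L0 * L1 + e * L1\<^sup>2) * \<rho>\<^sup>2 + (L1 - 2 * L0) * \<rho> + 1)"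
      using \<open>Q \<noteq> 0\<close> unfolding power_divide Y model \<rho> by simp
    then show "\<rho> \<in> ?R" by blast
  qed
  ultimately show "infinite ?R" using infinite_super by blast
qed

section \<open>The exceptional values \<open>e = 1\<close>, \<open>e = - 1\<close> and
  \<open>e = 1/3\<close>\<close>

lemma val2_ge_numeral: "val2_ge (numeral k) 0" "val2_ge (- numeral k) 0"
  using val2_ge_of_int[of "numeral k"] val2_ge_of_int[of "- numeral k"] by simp_all

text \<open>The starting points below come from the sporadic solutions \<open>(70/19, 10/13, 2/5)\<close> for \<open>e = 1\<close>,
  \<open>(- 18/11, 2/5, 2/3)\<close> for \<open>e = - 1\<close> (doubled once), and \<open>(- 31/25, - 1/7, - 5/3)\<close> for
  \<open>e = 1/3\<close>, all found by computer search; a linear change of \<open>\<rho>\<close> moves a 2-torsion point to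
  \<open>(0, 0)\<close> and makes the model integral.\<close>

lemma infinite_normalized_solutions_1: "infinite (normalized_solutions 1)"
proof (rule infinite_normalized_solutions_elliptic_fibre[where z = "2/5" and ?L1.0 = "- 1509/100"
    and ?L0.0 = "69/25" and a = 233249 and b = 4569760000 and ?X0.0 = "73125/4"
    and ?Y0.0 = "103569375/8" and N = 1 and l = 503 and R = 7030400 and Q = "- 672123816/5"])
  show "val2 (73125/4) (- 2 * 1)"
    using val2_odd_fraction[of 73125 2] by simp
qed (simp_all add: val2_ge_numeral field_simps power2_eq_square power3_eq_cube)

lemma infinite_normalized_solutions_minus_1: "infinite (normalized_solutions (- 1))"
proof (rule infinite_normalized_solutions_elliptic_fibre[where z = "2/3" and ?L1.0 = "187/36"
    and ?L0.0 = "- 29/9" and a = 32329 and b = 20736 and ?X0.0 = "3249/784"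
    and ?Y0.0 = "17578287/21952" and N = 2 and l = 187 and R = 1152 and Q = "- 18616/3"])
  \<comment> \<open>\<open>784 = 2^4 * 49\<close>, and 3249 is odd.\<close>
  show "val2 (3249/784) (- 2 * 2)"
    using val2_divide[OF val2_odd_fraction[of 3249 4] val2_odd_fraction[of 49 0]] by simp
qed (simp_all add: val2_ge_numeral field_simps power2_eq_square power3_eq_cube)

lemma infinite_normalized_solutions_third: "infinite (normalized_solutions (1/3))"
proof (rule infinite_normalized_solutions_elliptic_fibre[where z = "- 5/3" and ?L1.0 = "406/225"
    and ?L0.0 = "8/9" and a = "- 10466" and b = 160655625 and ?X0.0 = "2471625/256"
    and ?Y0.0 = "4975381125/4096" and N = 4 and l = 203 and R = "- 4119375" and Q = "29483740/9"])
  show "val2 (2471625/256) (- 2 * 4)"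
    using val2_odd_fraction[of 2471625 8] by simp
qed (simp_all add: val2_ge_numeral field_simps power2_eq_square power3_eq_cube)

theorem theorem1p3:
  fixes A B C :: int
  assumes "A * B * C \<noteq> 0"
  shows "infinite (nontrivial_solutions A B C)"
proof -
  have ABC: "A \<noteq> 0" "B \<noteq> 0" "C \<noteq> 0" using assms by auto
  define c where "c = ((of_int B)\<^sup>2 / of_int (A * C) :: rat)"
  have c: "c \<noteq> 0" "of_int (A * C) / (of_int B)\<^sup>2 = 1 / c" using ABC by (auto simp: c_def)
  have "infinite (normalized_solutions (1 / c))"
  \<comment> \<open>The values 1, 3 and -1 of \<open>c\<close>, for which \<open>P\<close> is
    torsion, correspond to \<open>e = 1\<close>, \<open>1/3\<close> and \<open>- 1\<close>.\<close>
  proof (cases "c = 1 \<or> c = 3 \<or> c = - 1")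
    case True
    then show ?thesis
      using infinite_normalized_solutions_1 infinite_normalized_solutions_minus_1
        infinite_normalized_solutions_third by auto
  next
    case False
    then show ?thesis using c(1) by (intro infinite_normalized_solutions_generic) auto
  qed
  then show ?thesis
    using ABC c(2) by (intro infinite_nontrivial_solutions_if_normalized) auto
qed

end
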